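(* Let $\Lambda^k$ be the space of exterior $k$-forms on $\mathbb{R}^4$ and let $[\varphi]^{(k)}$ denote the proxy of $\varphi\in\Lambda^k$. The following identities hold for the wedge product: \begin{align*} [\eta\wedge\varphi]^{(k)}=[\varphi\wedge\eta]^{(k)}&=[\varphi]^{(0)}\,[\eta]^{(k)},&&\varphi\in\Lambda^0,\ \eta\in\Lambda^k,\ k=0,\dots,4,\\ -[\eta\wedge\varphi]^{(2)}=[\varphi\wedge\eta]^{(2)}&=[\varphi]^{(1)}\times[\eta]^{(1)},&&\varphi\in\Lambda^1,\ \eta\in\Lambda^1,\\ [\eta\wedge\varphi]^{(3)}=[\varphi\wedge\eta]^{(3)}&=[\eta]^{(2)}\,[\varphi]^{(1)},&&\varphi\in\Lambda^1,\ \eta\in\Lambda^2,\\ -[\eta\wedge\varphi]^{(4)}=[\varphi\wedge\eta]^{(4)}&=[\varphi]^{(1)}\cdot[\eta]^{(3)},&&\varphi\in\Lambda^1,\ \eta\in\Lambda^3,\\ [\eta\wedge\varphi]^{(4)}=[\varphi\wedge\eta]^{(4)}&=[\varphi]^{(2)}\times[\eta]^{(2)},&&\varphi\in\Lambda^2,\ \eta\in\Lambda^2. \end{align*} The values of forms applied to vectors $u,v,w,z\in\mathbb{R}^4$ are given by \begin{align*} \varphi(v)&=[\varphi]^{(1)}\cdot v,&&\varphi\in\Lambda^1,\\ \varphi(u,v)&=[\varphi]^{(2)}:(u\times v),&&\varphi\in\Lambda^2,\\ \varphi(u,v,w)&=\det\big[[\varphi]^{(3)},u,v,w\big],&&\varphi\in\Lambda^3,\\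 \varphi(u,v,w,z)&=[\varphi]^{(4)}\det[u,v,w,z],&&\varphi\in\Lambda^4. \end{align*}
   Context: Write $\varphi\in\Lambda^k$ as $\varphi=\sum_{1\le i_1<\cdots<i_k\le4}\varphi_{i_1\cdots i_k}\,dx^{i_1}\wedge\cdots\wedge dx^{i_k}$. Let $\varepsilon_{ijkl}$ be the Levi-Civita permutation symbol on $\{1,2,3,4\}$ (zero if two indices are equal, otherwise the sign of the permutation) and let $\mathbb{K}$ be the space of real $4\times4$ skew-symmetric matrices. The proxy $[\varphi]^{(k)}$ is: $[\varphi]^{(0)}=\varphi\in\mathbb{R}$; $[\varphi]^{(1)}=(\varphi_1,\varphi_2,\varphi_3,\varphi_4)^\top\in\mathbb{R}^4$; $[\varphi]^{(2)}\in\mathbb{K}$ with entries $[\varphi]^{(2)}_{ij}=\sum_{1\le k<l\le4}\varepsilon_{ijkl}\varphi_{kl}$; $[\varphi]^{(3)}\in\mathbb{R}^4$ with components $[\varphi]^{(3)}_i=\sum_{1\le j<k<l\le4}\varepsilon_{ijkl}\varphi_{jkl}$, i.e. $(\varphi_{234},-\varphi_{134},\varphi_{124},-\varphi_{123})^\top$; and $[\varphi]^{(4)}=\varphi_{1234}\in\mathbb{R}$. Two cross products are used: for $u,v\in\mathbb{R}^4$, $u\times v\in\mathbb{K}$ is given by $[u\times v]_{ij}=\sum_{k,l=1}^4\varepsilon_{ijkl}u_kv_l$; for $\kappa,\eta\in\mathbb{K}$, $\kappa\times\eta=\sum_{1\le i<j\le4}\sum_{1\le k<l\le4}\varepsilon_{ijkl}\kappa_{ij}\eta_{kl}\in\mathbb{R}$.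 Juxtaposition denotes scalar multiplication or matrix-vector product, $\cdot$ the inner product of two vectors in $\mathbb{R}^4$, and $:$ the Frobenius inner product between matrices. $[a,b,c,e]$ inside $\det$ denotes the $4\times4$ matrix with the given columns.
   Formalization: The formula for 2-forms is proved as φ(u,v) = ½ [φ]^(2):(u×v); without the factor ½ it fails for the full Frobenius product, e.g. φ = dx¹∧dx², u = e₁, v = e₂ gives φ(u,v) = 1 but [φ]^(2):(u×v) = 2. *)

theory Defs
  imports "HOL-Analysis.Analysis" "HOL-Combinatorics.Permutations"
begin

section \<open>Indices\<close>

text \<open>
  Indices live in the four-element type \<open>4\<close>, whose numerals are \<open>1, 2, 3, 4\<close>. In that type
  \<open>4 = 0\<close>, so its built-in order puts \<open>4\<close> first; the order \<open>1 < 2 < 3 < 4\<close> is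
  therefore introduced separately.
\<close>

definition ix_less :: "4 \<Rightarrow> 4 \<Rightarrow> bool" (infix \<open><\<^sub>4\<close> 50) where
  "i <\<^sub>4 j \<longleftrightarrow> (i, j) \<in> {(1,2), (1,3), (1,4), (2,3), (2,4), (3,4)}"

definition incr_tuples :: "nat \<Rightarrow> 4 list set" where
  "incr_tuples k = {I. length I = k \<and> sorted_wrt (<\<^sub>4) I}"

definition levi_civita :: "4 \<Rightarrow> 4 \<Rightarrow> 4 \<Rightarrow> 4 \<Rightarrow> real" (\<open>\<epsilon>\<close>) where
  "\<epsilon> i j k l =
    (if distinct [i, j, k, l]
     then of_int (sign (\<lambda>m::4. if m = 1 then i else if m = 2 then j else if m = 3 then k else l))
     else 0)"

lemma levi_civita_swap: "\<epsilon> j i k l = - \<epsilon> i j k l"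
proof (cases "distinct [i, j, k, l]")
  case True
  define p where
    "p = (\<lambda>i j k l (m::4). if m = 1 then i else if m = 2 then j else if m = 3 then k else (l::4))"
  have vals: "p i j k l 1 = i" "p i j k l 2 = j" "p i j k l 3 = k" "p i j k l 4 = l"
    by (simp_all add: p_def)
  have "m = n" if "p i j k l m = p i j k l n" for m n
    using that True exhaust_4[of m] exhaust_4[of n] by (elim disjE; simp add: vals; fail)
  then have "inj (p i j k l)"
    by (rule injI)
  then have perm: "permutation (p i j k l)"
    by (simp add: permutation finite_UNIV_inj_surj bij_def)
  have "p j i k l m = (p i j k l \<circ> Transposition.transpose 1 2) m" for m
    by (simp add: p_def Transposition.transpose_def)
  then have comp: "p j i k l = p i j k l \<circ> Transposition.transpose 1 2"
    by blast
  have "sign (p j i k l) = - sign (p i j k l)"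
    unfolding comp by (simp add: sign_compose[OF perm permutation_swap_id] sign_swap_id)
  moreover have "distinct [j, i, k, l]"
    using True by auto
  ultimately show ?thesis
    using True unfolding levi_civita_def p_def by (simp del: distinct.simps)
next
  case False
  then have "\<not> distinct [j, i, k, l]"
    by auto
  with False show ?thesis
    unfolding levi_civita_def by (simp del: distinct.simps)
qed


section \<open>Exterior forms\<close>

text \<open>
  A form takes the list of its vector arguments, so that \<open>\<phi> [u, v]\<close> is the value usually
  written \<open>\<phi>(u, v)\<close>; a \<open>k\<close>-form is normalised to vanish on lists whose length is not \<open>k\<close>.
  A \<open>0\<close>-form is the same thing as the real number \<open>\<phi> []\<close>.
\<close>

type_synonym form = "(real^4) list \<Rightarrow> real"

definition forms :: "nat \<Rightarrow> form set" (\<open>\<Lambda>\<close>) where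
  "\<Lambda> k = {\<phi>.
     (\<forall>vs. length vs \<noteq> k \<longrightarrow> \<phi> vs = 0) \<and>
     (\<forall>vs i. length vs = k \<and> i < k \<longrightarrow> linear (\<lambda>x. \<phi> (vs[i := x]))) \<and>
     (\<forall>vs i j. length vs = k \<and> i < j \<and> j < k \<and> vs ! i = vs ! j \<longrightarrow> \<phi> vs = 0)}"

text \<open>
  For \<open>\<phi> \<in> \<Lambda> k\<close> and \<open>\<eta> \<in> \<Lambda> l\<close> only the summand \<open>p = k\<close> survives, and only for
  \<open>k + l\<close> arguments; it is the usual
  \<open>1 / (k! l!) (\<Sum>\<sigma>. sign \<sigma> * \<phi>(v \<sigma>(1), \<dots>, v \<sigma>(k)) * \<eta>(v \<sigma>(k+1), \<dots>, v \<sigma>(k+l)))\<close>.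
  Summing over \<open>p\<close> saves having to pass the degrees.
\<close>

definition wedge :: "form \<Rightarrow> form \<Rightarrow> form" (infixr \<open>\<and>\<^sub>w\<close> 70) where
  "(\<phi> \<and>\<^sub>w \<eta>) vs =
    (\<Sum>p\<le>length vs.
       (1 / (fact p * fact (length vs - p))) *
       (\<Sum>\<sigma> | \<sigma> permutes {..<length vs}.
          of_int (sign \<sigma>) * \<phi> (take p (permute_list \<sigma> vs)) * \<eta> (drop p (permute_list \<sigma> vs))))"

definition dx :: "4 \<Rightarrow> form" where
  "dx i vs = (case vs of [v] \<Rightarrow> v $ i | _ \<Rightarrow> 0)"

definition unit_form :: form where
  "unit_form vs = (if vs = [] then 1 else 0)"

definition dx_wedge :: "4 list \<Rightarrow> form" where
  "dx_wedge I = foldr (\<and>\<^sub>w) (map dx I) unit_form"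

text \<open>
  \<open>coeff k \<phi> [i\<^sub>1, \<dots>, i\<^sub>k]\<close> is the coefficient of \<open>dx i\<^sub>1 \<and>\<^sub>w \<dots> \<and>\<^sub>w dx i\<^sub>k\<close> in the
  expansion of \<open>\<phi> \<in> \<Lambda> k\<close> over increasing multi-indices; the first condition only
  fixes the value of the coefficient function outside its intended domain.
\<close>

definition coeff :: "nat \<Rightarrow> form \<Rightarrow> 4 list \<Rightarrow> real" where
  "coeff k \<phi> = (THE c. (\<forall>I. I \<notin> incr_tuples k \<longrightarrow> c I = 0) \<and>
                        \<phi> = (\<lambda>vs. \<Sum>I\<in>incr_tuples k. c I * dx_wedge I vs))"


section \<open>Proxies\<close>

definition skew_matrices :: "(real^4^4) set" (\<open>\<bbbK>\<close>) where
  "\<bbbK> = {A. Finite_Cartesian_Product.transpose A = - A}"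

definition proxy0 :: "form \<Rightarrow> real" where
  "proxy0 \<phi> = coeff 0 \<phi> []"

definition proxy1 :: "form \<Rightarrow> real^4" where
  "proxy1 \<phi> = (\<chi> i. coeff 1 \<phi> [i])"

definition proxy2 :: "form \<Rightarrow> real^4^4" where
  "proxy2 \<phi> = (\<chi> i j. \<Sum>(k, l) | k <\<^sub>4 l. \<epsilon> i j k l * coeff 2 \<phi> [k, l])"

lemma proxy2_skew: "proxy2 \<phi> \<in> \<bbbK>"
proof -
  have *: "proxy2 \<phi> $ j $ i = - (proxy2 \<phi> $ i $ j)" for i j
    by (simp add: proxy2_def levi_civita_swap[of j i] case_prod_unfold sum_negf)
  show ?thesis
    by (simp add: skew_matrices_def Finite_Cartesian_Product.transpose_def vec_eq_iff)
      (intro allI *)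
qed

definition proxy3 :: "form \<Rightarrow> real^4" where
  "proxy3 \<phi> = (\<chi> i. \<Sum>(j, k, l) | j <\<^sub>4 k \<and> k <\<^sub>4 l. \<epsilon> i j k l * coeff 3 \<phi> [j, k, l])"

definition proxy4 :: "form \<Rightarrow> real" where
  "proxy4 \<phi> = coeff 4 \<phi> [1, 2, 3, 4]"


section \<open>Cross products and determinants\<close>

text \<open>
  \<open>u \<times>\<^sub>v v\<close> and \<open>proxy2 \<phi>\<close> are full skew matrices, so their Frobenius inner product
  (the library's \<open>\<bullet>\<close> on \<open>real^4^4\<close>) counts every pair \<open>{i, j}\<close> twice:
  \<open>A \<bullet> B = 2 * (\<Sum>(i, j) | i <\<^sub>4 j. A $ i $ j * B $ i $ j)\<close> for \<open>A, B \<in> \<bbbK>\<close>. For instance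
  \<open>\<phi> = dx 1 \<and>\<^sub>w dx 2\<close>, \<open>u = axis 1 1\<close>, \<open>v = axis 2 1\<close> give \<open>\<phi> [u, v] = 1\<close> but
  \<open>proxy2 \<phi> \<bullet> (u \<times>\<^sub>v v) = 2\<close>. The value of a \<open>2\<close>-form is therefore half that inner product.
\<close>

definition cross_vec :: "real^4 \<Rightarrow> real^4 \<Rightarrow> real^4^4" (infix \<open>\<times>\<^sub>v\<close> 70) where
  "u \<times>\<^sub>v v = (\<chi> i j. \<Sum>k\<in>UNIV. \<Sum>l\<in>UNIV. \<epsilon> i j k l * u $ k * v $ l)"

lemma cross_vec_skew: "u \<times>\<^sub>v v \<in> \<bbbK>"
proof -
  have *: "(u \<times>\<^sub>v v) $ j $ i = - ((u \<times>\<^sub>v v) $ i $ j)" for i j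
    by (simp add: cross_vec_def levi_civita_swap[of j i] sum_negf)
  show ?thesis
    by (simp add: skew_matrices_def Finite_Cartesian_Product.transpose_def vec_eq_iff)
      (intro allI *)
qed

definition cross_skew :: "real^4^4 \<Rightarrow> real^4^4 \<Rightarrow> real" (infix \<open>\<times>\<^sub>K\<close> 70) where
  "\<kappa> \<times>\<^sub>K \<eta> = (\<Sum>(i, j) | i <\<^sub>4 j. \<Sum>(k, l) | k <\<^sub>4 l. \<epsilon> i j k l * \<kappa> $ i $ j * \<eta> $ k $ l)"

definition det_cols :: "real^4 \<Rightarrow> real^4 \<Rightarrow> real^4 \<Rightarrow> real^4 \<Rightarrow> real" where
  "det_cols a b c e = det (Finite_Cartesian_Product.transpose (vector [a, b, c, e] :: real^4^4))"

end

theory Submission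
  imports Defs
begin

text \<open>
  An alternating multilinear form is determined by its values on the strictly increasing tuples of
  standard basis vectors, and the forms \<open>dx_wedge I\<close> are dual to these tuples. Hence the
  coefficients of \<open>\<phi>\<close> are its values \<open>\<phi>(e\<^sub>i\<^sub>1, \<dots>, e\<^sub>i\<^sub>k)\<close>, and every identity reduces to comparing
  components. The wedge product is evaluated by collapsing the sum over all permutations to one
  over shuffles.
\<close>

section \<open>Sums over permutations of at most four elements\<close>

text \<open>\<open>coeff\<close> is a definite description, so a proxy has no accessible value until
  the expansion in the \<open>dx_wedge I\<close> is known to exist and to be unique. As
  \<open>dx_wedge I\<close> is an iterated wedge, closure of the forms under
  \<open>\<and>\<^sub>w\<close> has to come before that, in all degrees. The signs in the identities
  have one source: \<open>proxy2\<close> and \<open>proxy3\<close> act like a Hodge star, storing a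
  coefficient at the complementary indices with the sign \<open>\<epsilon>\<close>. The products of
  proxies pair complementary indices, so these signs become shuffle signs or cofactor signs.\<close>

lemma vector_4 [simp]:
  "(vector [x, y, z, w] :: 'a::zero^4) $ 1 = x" "(vector [x, y, z, w] :: 'a^4) $ 2 = y"
  "(vector [x, y, z, w] :: 'a^4) $ 3 = z" "(vector [x, y, z, w] :: 'a^4) $ 4 = w"
  unfolding vector_def by simp_all

text \<open>Leibniz formula. Each permutation is a transposition composed with a permutation of the
  remaining indices; splitting off one index at a time leaves the singleton \<open>{4}\<close> and
  24 products.\<close>

lemma det_4:
  fixes A :: "'a::comm_ring_1^4^4"
  shows "det A =
    A$1$1 * A$2$2 * A$3$3 * A$4$4 - A$1$1 * A$2$2 * A$3$4 * A$4$3
  - A$1$1 * A$2$3 * A$3$2 * A$4$4 + A$1$1 * A$2$3 * A$3$4 * A$4$2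
  + A$1$1 * A$2$4 * A$3$2 * A$4$3 - A$1$1 * A$2$4 * A$3$3 * A$4$2
  - A$1$2 * A$2$1 * A$3$3 * A$4$4 + A$1$2 * A$2$1 * A$3$4 * A$4$3
  + A$1$2 * A$2$3 * A$3$1 * A$4$4 - A$1$2 * A$2$3 * A$3$4 * A$4$1
  - A$1$2 * A$2$4 * A$3$1 * A$4$3 + A$1$2 * A$2$4 * A$3$3 * A$4$1
  + A$1$3 * A$2$1 * A$3$2 * A$4$4 - A$1$3 * A$2$1 * A$3$4 * A$4$2
  - A$1$3 * A$2$2 * A$3$1 * A$4$4 + A$1$3 * A$2$2 * A$3$4 * A$4$1
  + A$1$3 * A$2$4 * A$3$1 * A$4$2 - A$1$3 * A$2$4 * A$3$2 * A$4$1
  - A$1$4 * A$2$1 * A$3$2 * A$4$3 + A$1$4 * A$2$1 * A$3$3 * A$4$2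
  + A$1$4 * A$2$2 * A$3$1 * A$4$3 - A$1$4 * A$2$2 * A$3$3 * A$4$1
  - A$1$4 * A$2$3 * A$3$1 * A$4$2 + A$1$4 * A$2$3 * A$3$2 * A$4$1"
proof -
  have f: "finite {2::4, 3, 4}" "1 \<notin> {2::4, 3, 4}" "finite {3::4, 4}" "2 \<notin> {3::4, 4}"
     "finite {4::4}" "3 \<notin> {4::4}"
    by simp_all
  show ?thesis
    unfolding det_def UNIV_4
    unfolding sum_over_permutations_insert[OF f(1,2)] sum_over_permutations_insert[OF f(3,4)]
      sum_over_permutations_insert[OF f(5,6)] permutes_sing
    by (simp add: sign_swap_id permutation_swap_id sign_compose sign_id permutation_compose
       Transposition.transpose_def algebra_simps)
qed

text \<open>The summand is an arbitrary function \<open>f\<close> of the permuted list, so that one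
  enumeration serves every way of cutting the list into the arguments of two factors.\<close>

lemma sum_permutes_2:
  "(\<Sum>\<sigma> | \<sigma> permutes {..<2::nat}. of_int (sign \<sigma>) * (f (permute_list \<sigma> [a, b]) :: real)) =
    f [a, b] - f [b, a]"
proof -
  have f: "finite {1::nat}" "0 \<notin> {1::nat}" by simp_all
  have u: "{..<2::nat} = {0,1}" by auto
  show ?thesis
    unfolding u
    unfolding sum_over_permutations_insert[OF f(1,2)] permutes_sing
    by (simp add: sign_swap_id permutation_swap_id sign_compose sign_id permutation_compose
       Transposition.transpose_def permute_list_def)
qed

lemma sum_permutes_3:
  "(\<Sum>\<sigma> | \<sigma> permutes {..<3::nat}. of_int (sign \<sigma>) * (f (permute_list \<sigma> [a, b, c]) :: real)) =
    f [a, b, c] - f [a, c, b] - f [b, a, c] + f [b, c, a] + f [c, a, b] - f [c, b, a]"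
proof -
  have f: "finite {1::nat,2}" "0 \<notin> {1::nat,2}" "finite {2::nat}" "1 \<notin> {2::nat}" by simp_all
  have u: "{..<3::nat} = {0,1,2}" by auto
  show ?thesis
    unfolding u
    unfolding sum_over_permutations_insert[OF f(1,2)] sum_over_permutations_insert[OF f(3,4)]
      permutes_sing
    by (simp add: sign_swap_id permutation_swap_id sign_compose sign_id permutation_compose
       Transposition.transpose_def permute_list_def numeral_3_eq_3)
qed

lemma permute_list_4:
  "permute_list \<sigma> [a, b, c, d] = map (\<lambda>i. [a, b, c, d] ! \<sigma> i) [0, 1, 2, 3]"
  by (simp add: permute_list_def upt_rec numeral_eq_Suc)

lemma sum_permutes_4:
  "(\<Sum>\<sigma> | \<sigma> permutes {..<4::nat}. of_int (sign \<sigma>) * (f (permute_list \<sigma> [a, b, c, d]) :: real)) =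
      f [a, b, c, d] - f [a, b, d, c] - f [a, c, b, d] + f [a, c, d, b] + f [a, d, b, c] - f [a, d, c, b]
    - f [b, a, c, d] + f [b, a, d, c] + f [b, c, a, d] - f [b, c, d, a] - f [b, d, a, c] + f [b, d, c, a]
    + f [c, a, b, d] - f [c, a, d, b] - f [c, b, a, d] + f [c, b, d, a] + f [c, d, a, b] - f [c, d, b, a]
    - f [d, a, b, c] + f [d, a, c, b] + f [d, b, a, c] - f [d, b, c, a] - f [d, c, a, b] + f [d, c, b, a]"
proof -
  have f: "finite {1::nat,2,3}" "0 \<notin> {1::nat,2,3}"
   "finite {2::nat,3}" "1 \<notin> {2::nat,3}" "finite {3::nat}" "2 \<notin> {3::nat}" by simp_all
  have u: "{..<4::nat} = {0,1,2,3}" by auto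
  show ?thesis
    unfolding u
    unfolding sum_over_permutations_insert[OF f(1,2)] sum_over_permutations_insert[OF f(3,4)]
     sum_over_permutations_insert[OF f(5,6)] permutes_sing
    by (simp add: sign_swap_id permutation_swap_id sign_compose sign_id permutation_compose
       Transposition.transpose_def permute_list_4)
qed

section \<open>The Levi-Civita symbol\<close>

text \<open>Read as a function of the index map \<open>y\<close>, the symbol is the sign of
  \<open>y\<close>. Composing with a transposition exchanges two slots and reverses the sign; if
  \<open>y\<close> is not injective, neither is \<open>x\<close>, and both sides vanish.\<close>

lemma levi_civita_compose:
  assumes "a \<noteq> b" and x: "\<And>m. x m = y (Transposition.transpose a b m)"
  shows "\<epsilon> (x 1) (x 2) (x 3) (x 4) = - \<epsilon> (y 1) (y 2) (y 3) (y (4::4))"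
proof -
  \<comment> \<open>The type has four elements, so the function under \<open>sign\<close> in
    \<open>levi_civita_def\<close> is the index map itself.\<close>
  have ext: "(\<lambda>m::4. if m = 1 then z 1 else if m = 2 then z 2 else if m = 3 then z 3 else z 4) = z"
    for z :: "4 \<Rightarrow> 4"
    by (rule ext) (use exhaust_4 in auto)
  have d: "distinct [z 1, z 2, z 3, z 4] \<longleftrightarrow> inj z" for z :: "4 \<Rightarrow> 4"
  proof -
    have "inj z \<longleftrightarrow> distinct (map z [1,2,3,4])"
      unfolding distinct_map by (simp add: UNIV_4[symmetric])
    then show ?thesis by simp
  qed
  have xy: "x = y \<circ> Transposition.transpose a b"
    using x by auto
  have "inj x \<longleftrightarrow> inj y"
    unfolding xy by (metis bij_transpose bij_betw_def comp_assoc comp_id inj_compose transpose_comp_involutory)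
  moreover have "sign x = - sign y" if "inj y"
  proof -
    have "permutation y"
      using that by (simp add: permutation finite_UNIV_inj_surj bij_def)
    then show ?thesis
      unfolding xy using \<open>a \<noteq> b\<close>
      by (simp add: sign_compose[OF _ permutation_swap_id] sign_swap_id)
  qed
  ultimately show ?thesis
    unfolding levi_civita_def d ext by simp
qed

lemma levi_civita_1234: "\<epsilon> 1 2 3 4 = 1"
proof -
  have "(\<lambda>m::4. if m = 1 then 1 else if m = 2 then 2 else if m = 3 then 3 else 4) = id"
    by (rule ext) (use exhaust_4 in auto)
  then show ?thesis
    unfolding levi_civita_def by (simp add: sign_id)
qed

lemma levi_civita_swap_middle: "\<epsilon> i k j l = - \<epsilon> i j k l"
proof -
  define y where "y = (\<lambda>m::4. if m = 1 then i else if m = 2 then j else if m = 3 then k else l)"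
  have "\<epsilon> ((y \<circ> Transposition.transpose 2 3) 1) ((y \<circ> Transposition.transpose 2 3) 2)
     ((y \<circ> Transposition.transpose 2 3) 3) ((y \<circ> Transposition.transpose 2 3) 4) =
    - \<epsilon> (y 1) (y 2) (y 3) (y 4)"
    by (rule levi_civita_compose[of 2 3]) simp_all
  then show ?thesis
    by (simp add: y_def Transposition.transpose_def)
qed

lemma levi_civita_swap_right: "\<epsilon> i j l k = - \<epsilon> i j k l"
proof -
  define y where "y = (\<lambda>m::4. if m = 1 then i else if m = 2 then j else if m = 3 then k else l)"
  have "\<epsilon> ((y \<circ> Transposition.transpose 3 4) 1) ((y \<circ> Transposition.transpose 3 4) 2)
     ((y \<circ> Transposition.transpose 3 4) 3) ((y \<circ> Transposition.transpose 3 4) 4) =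
    - \<epsilon> (y 1) (y 2) (y 3) (y 4)"
    by (rule levi_civita_compose[of 3 4]) simp_all
  then show ?thesis
    by (simp add: y_def Transposition.transpose_def)
qed

lemma levi_civita_zero [simp]:
  "\<epsilon> i i k l = 0" "\<epsilon> i k i l = 0" "\<epsilon> i k l i = 0" "\<epsilon> k i i l = 0" "\<epsilon> k i l i = 0" "\<epsilon> k l i i = 0"
  by (simp_all add: levi_civita_def)

text \<open>Adjacent exchanges generate all permutations: each value is one exchange away from an
  earlier one. Together with \<open>levi_civita_zero\<close> these rules let the simplifier evaluate
  every component sum.\<close>

lemma levi_civita_values [simp]:
  "\<epsilon> 1 2 3 4 = 1" "\<epsilon> 1 2 4 3 = -1" "\<epsilon> 1 3 2 4 = -1" "\<epsilon> 1 3 4 2 = 1" "\<epsilon> 1 4 2 3 = 1" "\<epsilon> 1 4 3 2 = -1"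
  "\<epsilon> 2 1 3 4 = -1" "\<epsilon> 2 1 4 3 = 1" "\<epsilon> 2 3 1 4 = 1" "\<epsilon> 2 3 4 1 = -1" "\<epsilon> 2 4 1 3 = -1" "\<epsilon> 2 4 3 1 = 1"
  "\<epsilon> 3 1 2 4 = 1" "\<epsilon> 3 1 4 2 = -1" "\<epsilon> 3 2 1 4 = -1" "\<epsilon> 3 2 4 1 = 1" "\<epsilon> 3 4 1 2 = 1" "\<epsilon> 3 4 2 1 = -1"
  "\<epsilon> 4 1 2 3 = -1" "\<epsilon> 4 1 3 2 = 1" "\<epsilon> 4 2 1 3 = 1" "\<epsilon> 4 2 3 1 = -1" "\<epsilon> 4 3 1 2 = -1" "\<epsilon> 4 3 2 1 = 1"
proof -
  note L = levi_civita_swap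
  note M = levi_civita_swap_middle
  note R = levi_civita_swap_right
  show 1: "\<epsilon> 1 2 3 4 = 1" by (rule levi_civita_1234)
  show 2: "\<epsilon> 1 2 4 3 = -1" using 1 R[of 1 2 4 3] by simp
  show 3: "\<epsilon> 1 3 2 4 = -1" using 1 M[of 1 3 2 4] by simp
  show 4: "\<epsilon> 1 3 4 2 = 1" using 3 R[of 1 3 4 2] by simp
  show 5: "\<epsilon> 1 4 2 3 = 1" using 2 M[of 1 4 2 3] by simp
  show 6: "\<epsilon> 1 4 3 2 = -1" using 5 R[of 1 4 3 2] by simp
  show 7: "\<epsilon> 2 1 3 4 = -1" using 1 L[of 2 1 3 4] by simp
  show 8: "\<epsilon> 2 1 4 3 = 1" using 7 R[of 2 1 4 3] by simp
  show 9: "\<epsilon> 2 3 1 4 = 1" using 7 M[of 2 3 1 4] by simp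
  show 10: "\<epsilon> 2 3 4 1 = -1" using 9 R[of 2 3 4 1] by simp
  show 11: "\<epsilon> 2 4 1 3 = -1" using 8 M[of 2 4 1 3] by simp
  show 12: "\<epsilon> 2 4 3 1 = 1" using 11 R[of 2 4 3 1] by simp
  show 13: "\<epsilon> 3 1 2 4 = 1" using 3 L[of 3 1 2 4] by simp
  show 14: "\<epsilon> 3 1 4 2 = -1" using 4 L[of 3 1 4 2] by simp
  show 15: "\<epsilon> 3 2 1 4 = -1" using 9 L[of 3 2 1 4] by simp
  show 16: "\<epsilon> 3 2 4 1 = 1" using 10 L[of 3 2 4 1] by simp
  show 17: "\<epsilon> 3 4 1 2 = 1" using 14 M[of 3 4 1 2] by simp
  show 18: "\<epsilon> 3 4 2 1 = -1" using 17 R[of 3 4 2 1] by simp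
  show 19: "\<epsilon> 4 1 2 3 = -1" using 5 L[of 4 1 2 3] by simp
  show 20: "\<epsilon> 4 1 3 2 = 1" using 6 L[of 4 1 3 2] by simp
  show 21: "\<epsilon> 4 2 1 3 = 1" using 11 L[of 4 2 1 3] by simp
  show 22: "\<epsilon> 4 2 3 1 = -1" using 12 L[of 4 2 3 1] by simp
  show 23: "\<epsilon> 4 3 1 2 = -1" using 17 L[of 4 3 1 2] by simp
  show "\<epsilon> 4 3 2 1 = 1" using 18 L[of 4 3 2 1] by simp
qed

section \<open>Alternating multilinear forms\<close>

lemma forms_length: "\<phi> \<in> \<Lambda> k \<Longrightarrow> length vs \<noteq> k \<Longrightarrow> \<phi> vs = 0"
  by (simp add: forms_def)

lemma forms_linear: "\<phi> \<in> \<Lambda> k \<Longrightarrow> length vs = k \<Longrightarrow> i < k \<Longrightarrow> linear (\<lambda>x. \<phi> (vs[i := x]))"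
  by (simp add: forms_def)

lemma forms_alternating:
  "\<phi> \<in> \<Lambda> k \<Longrightarrow> i < j \<Longrightarrow> j < k \<Longrightarrow> length vs = k \<Longrightarrow> vs ! i = vs ! j \<Longrightarrow> \<phi> vs = 0"
  unfolding forms_def by blast

lemma formsI:
  assumes "\<And>vs. length vs \<noteq> k \<Longrightarrow> \<phi> vs = 0"
    and "\<And>vs i. length vs = k \<Longrightarrow> i < k \<Longrightarrow> linear (\<lambda>x. \<phi> (vs[i := x]))"
    and "\<And>vs i j. length vs = k \<Longrightarrow> i < j \<Longrightarrow> j < k \<Longrightarrow> vs ! i = vs ! j \<Longrightarrow> \<phi> vs = 0"
  shows "\<phi> \<in> \<Lambda> k"
  unfolding forms_def using assms by blast

lemma forms_zero: "(\<lambda>vs. 0) \<in> \<Lambda> k"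
  by (rule formsI) (simp_all add: linear_zero)

lemma forms_scale: "\<phi> \<in> \<Lambda> k \<Longrightarrow> (\<lambda>vs. c * \<phi> vs) \<in> \<Lambda> k"
  by (rule formsI)
    (auto simp: forms_length forms_alternating intro: forms_linear
      linear_compose_scale_right[where 'b = real, unfolded real_scaleR_def])

lemma forms_add: "\<phi> \<in> \<Lambda> k \<Longrightarrow> \<eta> \<in> \<Lambda> k \<Longrightarrow> (\<lambda>vs. \<phi> vs + \<eta> vs) \<in> \<Lambda> k"
  by (rule formsI) (simp_all add: forms_length forms_alternating forms_linear linear_compose_add)

lemma forms_diff: "\<phi> \<in> \<Lambda> k \<Longrightarrow> \<eta> \<in> \<Lambda> k \<Longrightarrow> (\<lambda>vs. \<phi> vs - \<eta> vs) \<in> \<Lambda> k"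
  using forms_add[OF _ forms_scale, of \<phi> k \<eta> "-1"] by simp

lemma forms_sum: "(\<And>a. a \<in> S \<Longrightarrow> \<phi> a \<in> \<Lambda> k) \<Longrightarrow> (\<lambda>vs. \<Sum>a\<in>S. \<phi> a vs) \<in> \<Lambda> k"
  by (induction S rule: infinite_finite_induct) (simp_all add: forms_zero forms_add)

text \<open>Polarisation: with \<open>vs ! i + vs ! j\<close> in both slots the form vanishes, and
  additivity in each slot leaves only the two mixed terms.\<close>

lemma forms_swap:
  assumes \<phi>: "\<phi> \<in> \<Lambda> k" and vs: "length vs = k" "i < k" "j < k" "i \<noteq> j"
  shows "\<phi> (vs[i := vs ! j, j := vs ! i]) = - \<phi> vs"
proof -
  let ?F = "\<lambda>x y. \<phi> (vs[i := x, j := y])"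
  \<comment> \<open>The alternation axiom is stated for ordered positions only, hence
    \<open>min\<close> and \<open>max\<close>.\<close>
  have diag: "?F x x = 0" for x
    using forms_alternating[OF \<phi>, of "min i j" "max i j" "vs[i := x, j := x]"] vs
    by (cases "i < j") (auto simp: min_def max_def nth_list_update)
  have right: "?F x (y + z) = ?F x y + ?F x z" for x y z
    using linear_add[OF forms_linear[OF \<phi>, of "vs[i := x]" j]] vs by simp
  have left: "?F (x + y) z = ?F x z + ?F y z" for x y z
    using linear_add[OF forms_linear[OF \<phi>, of "vs[j := z]" i]] vs
    by (simp add: list_update_swap)
  have "?F (vs ! i + vs ! j) (vs ! i + vs ! j) = 0"
    by (rule diag)
  then have "?F (vs ! i) (vs ! j) + ?F (vs ! j) (vs ! i) = 0"
    unfolding left right unfolding diag by simp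
  then show ?thesis
    by simp
qed

lemma permute_list_transpose:
  "i < length vs \<Longrightarrow> j < length vs \<Longrightarrow>
    permute_list (Transposition.transpose i j) vs = vs[i := vs ! j, j := vs ! i]"
  by (rule nth_equalityI)
    (auto simp: permute_list_def nth_list_update Transposition.transpose_def)

text \<open>Induction over products of transpositions. The new transposition is composed on the
  right because it then acts on the list already permuted by \<open>p\<close>, where
  \<open>forms_swap\<close> applies.\<close>

lemma forms_permute:
  assumes \<phi>: "\<phi> \<in> \<Lambda> k" and "length vs = k" and \<sigma>: "\<sigma> permutes {..<k}"
  shows "\<phi> (permute_list \<sigma> vs) = of_int (sign \<sigma>) * \<phi> vs"
  using finite_lessThan \<sigma>
proof (induction \<sigma> rule: permutes_rev_induct)
  case id
  then show ?case by (simp add: sign_id)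
next
  case (swap a b p)
  then have tr: "Transposition.transpose a b permutes {..<length vs}"
    using \<open>length vs = k\<close> by (simp add: permutes_swap_id)
  have p: "permutation p" using swap finite_lessThan permutation_permutes by blast
  have "sign (p \<circ> Transposition.transpose a b) = - sign p"
    using swap(3) by (simp add: sign_compose[OF p permutation_swap_id] sign_swap_id)
  moreover have "\<phi> (permute_list (p \<circ> Transposition.transpose a b) vs) = - \<phi> (permute_list p vs)"
    unfolding permute_list_compose[OF tr] using swap \<open>length vs = k\<close>
    by (simp add: permute_list_transpose forms_swap[OF \<phi>])
  ultimately show ?case
    using swap.IH by (simp del: o_apply add: comp_def[symmetric])
qed

section \<open>The wedge product of alternating forms\<close>

lemma wedge_eq:
  assumes "\<phi> \<in> \<Lambda> p" "\<eta> \<in> \<Lambda> q" "p + q = n" "length vs = n"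
  shows "(\<phi> \<and>\<^sub>w \<eta>) vs = (\<Sum>\<sigma> | \<sigma> permutes {..<n}. of_int (sign \<sigma>) *
    (\<phi> (take p (permute_list \<sigma> vs)) * \<eta> (drop p (permute_list \<sigma> vs)))) / (fact p * fact q)"
proof -
  \<comment> \<open>A cut at \<open>r \<noteq> p\<close> hands \<open>\<phi>\<close> the wrong
    number of arguments, where its value is the default \<open>0\<close>.\<close>
  have "(\<phi> \<and>\<^sub>w \<eta>) vs = (\<Sum>r\<le>n. if r = p then
      (1 / (fact p * fact q)) * (\<Sum>\<sigma> | \<sigma> permutes {..<n}.
          of_int (sign \<sigma>) * \<phi> (take p (permute_list \<sigma> vs)) * \<eta> (drop p (permute_list \<sigma> vs))) else 0)"
    unfolding wedge_def assms(4)
    by (rule sum.cong) (use assms in \<open>auto simp: forms_length[OF assms(1)] min_def\<close>)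
  then show ?thesis
    by (simp add: mult.assoc flip: assms(3))
qed

lemma wedge_length:
  assumes "\<phi> \<in> \<Lambda> p" "\<eta> \<in> \<Lambda> q" "length vs \<noteq> p + q"
  shows "(\<phi> \<and>\<^sub>w \<eta>) vs = 0"
  unfolding wedge_def
proof (intro sum.neutral ballI)
  fix r assume "r \<in> {..length vs}"
  then have "r \<noteq> p \<or> length vs - r \<noteq> q"
    using assms by auto
  then have "\<phi> (take r (permute_list \<sigma> vs)) * \<eta> (drop r (permute_list \<sigma> vs)) = 0" for \<sigma>
    using \<open>r \<in> _\<close> forms_length[OF assms(1), of "take r (permute_list \<sigma> vs)"]
      forms_length[OF assms(2), of "drop r (permute_list \<sigma> vs)"] by auto
  then show "1 / (fact r * fact (length vs - r)) *
     (\<Sum>\<sigma> | \<sigma> permutes {..<length vs}. of_int (sign \<sigma>) *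
        \<phi> (take r (permute_list \<sigma> vs)) * \<eta> (drop r (permute_list \<sigma> vs))) = 0"
    by (auto intro!: sum.neutral simp: mult.assoc simp del: mult_eq_0_iff)
qed

text \<open>Position \<open>m\<close> of the permuted list holds entry \<open>\<sigma> m\<close>, so
  entry \<open>i\<close> moves to position \<open>inv \<sigma> i\<close>. This reduces linearity of
  a permuted summand to linearity of one factor in one slot.\<close>

lemma permute_list_update:
  assumes "\<sigma> permutes {..<length vs}" "i < length vs"
  shows "permute_list \<sigma> (vs[i := x]) = (permute_list \<sigma> vs)[inv \<sigma> i := x]"
proof (rule nth_equalityI)
  fix m assume "m < length (permute_list \<sigma> (vs[i := x]))"
  then have m: "m < length vs" by simp
  then have "\<sigma> m < length vs" using permutes_in_image[OF assms(1), of m] by simp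
  moreover have "inv \<sigma> i = m \<longleftrightarrow> \<sigma> m = i"
    using permutes_inverses[OF assms(1)] by metis
  ultimately show "permute_list \<sigma> (vs[i := x]) ! m = (permute_list \<sigma> vs)[inv \<sigma> i := x] ! m"
    using m by (auto simp: permute_list_def nth_list_update)
qed simp

text \<open>Linearity holds summand by summand. For alternation, exchanging two equal arguments
  keeps every permuted list but reverses the sign of the permutation, so the summands
  cancel.\<close>

lemma wedge_in_forms:
  assumes \<phi>: "\<phi> \<in> \<Lambda> p" and \<eta>: "\<eta> \<in> \<Lambda> q"
  shows "\<phi> \<and>\<^sub>w \<eta> \<in> \<Lambda> (p + q)"
proof -
  let ?t = "\<lambda>vs \<sigma>. \<phi> (take p (permute_list \<sigma> vs)) * \<eta> (drop p (permute_list \<sigma> vs))"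
  have "linear (\<lambda>x. (\<phi> \<and>\<^sub>w \<eta>) (vs[i := x]))" if vs: "length vs = p + q" "i < p + q" for vs i
  proof -
    have "linear (\<lambda>x. ?t (vs[i := x]) \<sigma>)" if \<sigma>: "\<sigma> permutes {..<p + q}" for \<sigma>
    proof -
      have u: "permute_list \<sigma> (vs[i := x]) = (permute_list \<sigma> vs)[inv \<sigma> i := x]" for x
        using permute_list_update[of \<sigma> vs i] \<sigma> vs by simp
      have lt: "inv \<sigma> i < p + q"
        using permutes_in_image[OF permutes_inv[OF \<sigma>], of i] vs by simp
      show ?thesis
      \<comment> \<open>The varying argument is seen either by \<open>\<phi>\<close> or by
        \<open>\<eta>\<close>; the other factor is constant in it.\<close>
      proof (cases "inv \<sigma> i < p")
        case True
        then show ?thesis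
          unfolding u take_update_swap drop_update_cancel[OF True]
          using linear_compose_scale_right[where 'b = real, unfolded real_scaleR_def,
              OF forms_linear[OF \<phi>], of "take p (permute_list \<sigma> vs)" "inv \<sigma> i"
                "\<eta> (drop p (permute_list \<sigma> vs))"] vs
          by (simp add: mult.commute)
      next
        case False
        then have le: "p \<le> inv \<sigma> i" by simp
        show ?thesis
          unfolding u take_update_cancel[OF le] drop_update_swap[OF le]
          using lt vs le
          by (intro linear_compose_scale_right[where 'b = real, unfolded real_scaleR_def]
              forms_linear[OF \<eta>]) simp_all
      qed
    qed
    then have "linear (\<lambda>x. \<Sum>\<sigma> | \<sigma> permutes {..<p + q}. of_int (sign \<sigma>) * ?t (vs[i := x]) \<sigma>)"
      by (intro linear_compose_sum ballI
          linear_compose_scale_right[where 'b = real, unfolded real_scaleR_def]) simp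
    from linear_compose_scale_right[OF this, of "1 / (fact p * fact q)"] show ?thesis
      using wedge_eq[OF \<phi> \<eta> refl] vs by simp
  qed
  moreover have "(\<phi> \<and>\<^sub>w \<eta>) vs = 0"
    if vs: "length vs = p + q" "i < j" "j < p + q" "vs ! i = vs ! j" for vs i j
  proof -
    let ?S = "{\<sigma>. \<sigma> permutes {..<p + q}}" and ?\<tau> = "Transposition.transpose i j"
    let ?s = "\<lambda>\<sigma>. of_int (sign \<sigma>) * ?t vs \<sigma>"
    have \<tau>: "?\<tau> permutes {..<p + q}"
      using vs by (simp add: permutes_swap_id)
    have fix_vs: "permute_list ?\<tau> vs = vs"
      using vs by (simp add: permute_list_transpose) (metis list_update_id)
    have "?s (?\<tau> \<circ> \<sigma>) = - ?s \<sigma>" if \<sigma>: "\<sigma> \<in> ?S" for \<sigma>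
    proof -
      have "permutation \<sigma>"
        using \<sigma> finite_lessThan permutation_permutes by blast
      then have "sign (?\<tau> \<circ> \<sigma>) = - sign \<sigma>"
        using vs by (simp add: sign_compose[OF permutation_swap_id] sign_swap_id)
      moreover have "permute_list (?\<tau> \<circ> \<sigma>) vs = permute_list \<sigma> vs"
        using permute_list_compose[of \<sigma> vs ?\<tau>] \<sigma> vs fix_vs by simp
      ultimately show ?thesis by simp
    qed
    \<comment> \<open>Left composition with \<open>?\<tau>\<close> is a bijection of
      \<open>?S\<close>.\<close>
    then have "sum ?s ?S = - sum ?s ?S"
      using setum_permutations_compose_left[OF \<tau>, of ?s] by (simp add: sum_negf del: o_apply)
    then show ?thesis
      using wedge_eq[OF \<phi> \<eta> refl vs(1)] by simp
  qed
  ultimately show ?thesis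
    using wedge_length[OF \<phi> \<eta>] by (auto simp: forms_def)
qed

text \<open>By \<open>forms_permute\<close> the sign of each permutation occurs squared, so all
  \<open>k!\<close> summands are equal and cancel the factor \<open>1 / k!\<close>.\<close>

lemma wedge_0_left:
  assumes \<phi>: "\<phi> \<in> \<Lambda> 0" and \<eta>: "\<eta> \<in> \<Lambda> k"
  shows "\<phi> \<and>\<^sub>w \<eta> = (\<lambda>vs. \<phi> [] * \<eta> vs)"
proof
  fix vs
  show "(\<phi> \<and>\<^sub>w \<eta>) vs = \<phi> [] * \<eta> vs"
  proof (cases "length vs = k")
    case True
    have "(\<Sum>\<sigma> | \<sigma> permutes {..<k}. of_int (sign \<sigma>) * (\<phi> [] * \<eta> (permute_list \<sigma> vs))) =
       (\<Sum>\<sigma> | \<sigma> permutes {..<k}. \<phi> [] * \<eta> vs)"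
      by (intro sum.cong) (auto simp: forms_permute[OF \<eta> True] sign_def)
    then show ?thesis
      using wedge_eq[OF \<phi> \<eta> refl, of vs] True
      by (simp add: card_permutations)
  next
    case False
    then show ?thesis
      using wedge_length[OF \<phi> \<eta>, of vs] forms_length[OF \<eta>, of vs] by simp
  qed
qed

lemma wedge_0_right:
  assumes \<phi>: "\<phi> \<in> \<Lambda> k" and \<eta>: "\<eta> \<in> \<Lambda> 0"
  shows "\<phi> \<and>\<^sub>w \<eta> = (\<lambda>vs. \<phi> vs * \<eta> [])"
proof
  fix vs
  show "(\<phi> \<and>\<^sub>w \<eta>) vs = \<phi> vs * \<eta> []"
  proof (cases "length vs = k")
    case True
    have "(\<Sum>\<sigma> | \<sigma> permutes {..<k}. of_int (sign \<sigma>) * (\<phi> (permute_list \<sigma> vs) * \<eta> [])) =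
       (\<Sum>\<sigma> | \<sigma> permutes {..<k}. \<phi> vs * \<eta> [])"
      by (intro sum.cong) (auto simp: forms_permute[OF \<phi> True] sign_def)
    then show ?thesis
      using wedge_eq[OF \<phi> \<eta> refl, of vs] True
      by (simp add: card_permutations)
  next
    case False
    then show ?thesis
      using wedge_length[OF \<phi> \<eta>, of vs] forms_length[OF \<phi>, of vs] by simp
  qed
qed

section \<open>Wedge products in low degrees as sums over shuffles\<close>

lemma forms_swap_2: "\<phi> \<in> \<Lambda> 2 \<Longrightarrow> \<phi> [b, a] = - \<phi> [a, b]"
  using forms_swap[of \<phi> 2 "[a, b]" 0 1] by simp

lemma forms_swap_3:
  assumes "\<phi> \<in> \<Lambda> 3"
  shows "\<phi> [b, a, c] = - \<phi> [a, b, c]" "\<phi> [a, c, b] = - \<phi> [a, b, c]"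
  using forms_swap[OF assms, of "[a, b, c]" 0 1] forms_swap[OF assms, of "[a, b, c]" 1 2]
  by simp_all

lemma forms_permute_3:
  assumes "\<phi> \<in> \<Lambda> 3"
  shows "\<phi> [b, c, a] = \<phi> [a, b, c]" "\<phi> [c, a, b] = \<phi> [a, b, c]" "\<phi> [c, b, a] = - \<phi> [a, b, c]"
  using forms_swap_3[OF assms] by metis+

lemma wedge_1_1:
  assumes "\<phi> \<in> \<Lambda> 1" "\<eta> \<in> \<Lambda> 1"
  shows "(\<phi> \<and>\<^sub>w \<eta>) [a, b] = \<phi> [a] * \<eta> [b] - \<phi> [b] * \<eta> [a]"
  using wedge_eq[OF assms, of 2 "[a, b]"]
    sum_permutes_2[of "\<lambda>vs. \<phi> (take 1 vs) * \<eta> (drop 1 vs)" a b]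
  by simp

text \<open>Permutations that differ only in the order of the arguments of \<open>\<eta>\<close>
  contribute equally, since the sign of the permutation and that of \<open>\<eta>\<close> change
  together. Each shuffle thus occurs \<open>1! * 2!\<close> times, which cancels the denominator.
  The lemmas below follow the same pattern.\<close>

lemma wedge_1_2:
  assumes "\<phi> \<in> \<Lambda> 1" "\<eta> \<in> \<Lambda> 2"
  shows "(\<phi> \<and>\<^sub>w \<eta>) [a, b, c] = \<phi> [a] * \<eta> [b, c] - \<phi> [b] * \<eta> [a, c] + \<phi> [c] * \<eta> [a, b]"
proof -
  note s = forms_swap_2[OF assms(2)]
  show ?thesis
    using wedge_eq[OF assms, of 3 "[a, b, c]"]
      sum_permutes_3[of "\<lambda>vs. \<phi> (take 1 vs) * \<eta> (drop 1 vs)" a b c]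
    by (simp add: s[of c b] s[of c a] s[of b a] fact_numeral)
qed

lemma wedge_2_1:
  assumes "\<phi> \<in> \<Lambda> 2" "\<eta> \<in> \<Lambda> 1"
  shows "(\<phi> \<and>\<^sub>w \<eta>) [a, b, c] = \<phi> [a, b] * \<eta> [c] - \<phi> [a, c] * \<eta> [b] + \<phi> [b, c] * \<eta> [a]"
proof -
  note s = forms_swap_2[OF assms(1)]
  show ?thesis
    using wedge_eq[OF assms, of 3 "[a, b, c]"]
      sum_permutes_3[of "\<lambda>vs. \<phi> (take 2 vs) * \<eta> (drop 2 vs)" a b c]
    by (simp add: s[of c b] s[of c a] s[of b a] fact_numeral algebra_simps)
qed

lemma wedge_1_3:
  assumes "\<phi> \<in> \<Lambda> 1" "\<eta> \<in> \<Lambda> 3"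
  shows "(\<phi> \<and>\<^sub>w \<eta>) [a, b, c, d] =
    \<phi> [a] * \<eta> [b, c, d] - \<phi> [b] * \<eta> [a, c, d] + \<phi> [c] * \<eta> [a, b, d] - \<phi> [d] * \<eta> [a, b, c]"
proof -
  \<comment> \<open>All five unsorted orders of three arguments; the instances used below bring
    every term to alphabetical order.\<close>
  have s: "\<eta> [x, z, y] = - \<eta> [x, y, z]" "\<eta> [y, x, z] = - \<eta> [x, y, z]"
    "\<eta> [y, z, x] = \<eta> [x, y, z]" "\<eta> [z, x, y] = \<eta> [x, y, z]" "\<eta> [z, y, x] = - \<eta> [x, y, z]" for x y z
    using forms_swap_3[OF assms(2)] forms_permute_3[OF assms(2)] by metis+
  show ?thesis
    using wedge_eq[OF assms, of 4 "[a, b, c, d]"]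
      sum_permutes_4[of "\<lambda>vs. \<phi> (take 1 vs) * \<eta> (drop 1 vs)" a b c d]
    by (simp add: s[where x = b and y = c and z = d] s[where x = a and y = c and z = d]
        s[where x = a and y = b and z = d] s[where x = a and y = b and z = c] fact_numeral)
qed

lemma wedge_3_1:
  assumes "\<phi> \<in> \<Lambda> 3" "\<eta> \<in> \<Lambda> 1"
  shows "(\<phi> \<and>\<^sub>w \<eta>) [a, b, c, d] =
    \<phi> [a, b, c] * \<eta> [d] - \<phi> [a, b, d] * \<eta> [c] + \<phi> [a, c, d] * \<eta> [b] - \<phi> [b, c, d] * \<eta> [a]"
proof -
  have s: "\<phi> [x, z, y] = - \<phi> [x, y, z]" "\<phi> [y, x, z] = - \<phi> [x, y, z]"
    "\<phi> [y, z, x] = \<phi> [x, y, z]" "\<phi> [z, x, y] = \<phi> [x, y, z]" "\<phi> [z, y, x] = - \<phi> [x, y, z]" for x y z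
    using forms_swap_3[OF assms(1)] forms_permute_3[OF assms(1)] by metis+
  show ?thesis
    using wedge_eq[OF assms, of 4 "[a, b, c, d]"]
      sum_permutes_4[of "\<lambda>vs. \<phi> (take 3 vs) * \<eta> (drop 3 vs)" a b c d]
    by (simp add: s[where x = b and y = c and z = d] s[where x = a and y = c and z = d]
        s[where x = a and y = b and z = d] s[where x = a and y = b and z = c] fact_numeral algebra_simps)
qed

text \<open>The six terms are the splittings of four arguments into an ordered couple of pairs, each
  met \<open>2! * 2!\<close> times.\<close>

lemma wedge_2_2:
  assumes "\<phi> \<in> \<Lambda> 2" "\<eta> \<in> \<Lambda> 2"
  shows "(\<phi> \<and>\<^sub>w \<eta>) [a, b, c, d] =
    \<phi> [a, b] * \<eta> [c, d] - \<phi> [a, c] * \<eta> [b, d] + \<phi> [a, d] * \<eta> [b, c]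
    + \<phi> [b, c] * \<eta> [a, d] - \<phi> [b, d] * \<eta> [a, c] + \<phi> [c, d] * \<eta> [a, b]"
proof -
  note s = forms_swap_2[OF assms(1)] and t = forms_swap_2[OF assms(2)]
  show ?thesis
    using wedge_eq[OF assms, of 4 "[a, b, c, d]"]
      sum_permutes_4[of "\<lambda>vs. \<phi> (take 2 vs) * \<eta> (drop 2 vs)" a b c d]
    by (simp add: s[of b a] s[of c a] s[of d a] s[of c b] s[of d b] s[of d c]
       t[of b a] t[of c a] t[of d a] t[of c b] t[of d b] t[of d c] fact_numeral algebra_simps)
qed

section \<open>Forms are determined by increasing tuples of axes\<close>

lemma form_zero_if_axes:
  assumes \<phi>: "\<phi> \<in> \<Lambda> k" and 0: "\<And>J. length J = k \<Longrightarrow> \<phi> (map (\<lambda>i. axis i 1) J) = 0"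
  shows "\<phi> vs = 0"
proof -
  \<comment> \<open>Here \<open>n\<close> counts the leading slots that may hold arbitrary vectors;
    all later slots hold axes. The claim for all lists is \<open>n = k\<close>.\<close>
  have "\<phi> vs = 0" if "length vs = k" "n \<le> k" "\<forall>i. n \<le> i \<and> i < k \<longrightarrow> (\<exists>a. vs ! i = axis a 1)" for n vs
    using that
  proof (induction n arbitrary: vs)
    case 0
    then have "\<forall>i. \<exists>a. i < k \<longrightarrow> vs ! i = axis a 1" by blast
    then obtain f where "\<forall>i<k. vs ! i = axis (f i) 1" by metis
    then have "vs = map (\<lambda>i. axis i 1) (map f [0..<k])"
      using 0 by (intro nth_equalityI) auto
    then show ?case using assms(2)[of "map f [0..<k]"] by simp
  next
    case (Suc n)
    \<comment> \<open>With an axis in slot \<open>n\<close> one arbitrary slot fewer remains;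
      linearity in that slot then extends the vanishing from the basis to all vectors.\<close>
    have "\<phi> (vs[n := b]) = 0" if "b \<in> Basis" for b
      using Suc.prems that
      by (intro Suc.IH) (auto simp: nth_list_update Basis_vec_def not_less_eq_eq le_Suc_eq)
    then have "(\<lambda>x. \<phi> (vs[n := x])) = (\<lambda>x. 0)"
      using Suc.prems by (intro linear_eq_stdbasis forms_linear[OF \<phi>] linear_zero) auto
    then show ?case
      by (metis list_update_id)
  qed
  from this[of vs k] show ?thesis
    using forms_length[OF \<phi>] by force
qed

lemma incr_tuple_permutation:
  assumes "distinct J"
  obtains I \<sigma> where "I \<in> incr_tuples (length J)" "\<sigma> permutes {..<length I}" "J = permute_list \<sigma> I"
proof -
  \<comment> \<open>The rank \<open>r\<close> carries \<open><\<^sub>4\<close> to the order of the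
    natural numbers, so \<open>J\<close> can be sorted by key; equality of multisets then supplies
    \<open>\<sigma>\<close>.\<close>
  define r :: "4 \<Rightarrow> nat" where "r i = (if i = 1 then 1 else if i = 2 then 2 else if i = 3 then 3 else 4)" for i
  have r: "r i < r j \<longleftrightarrow> i <\<^sub>4 j" for i j
    using exhaust_4[of i] exhaust_4[of j] by (elim disjE) (simp_all add: r_def ix_less_def)
  have "r i = r j \<Longrightarrow> i = j" for i j
    using exhaust_4[of i] exhaust_4[of j] by (elim disjE) (simp_all add: r_def)
  then have "inj r" by (rule injI)
  then have "sorted_wrt (<) (map r (sort_key r J))"
    using assms unfolding strict_sorted_iff by (auto simp: distinct_map inj_on_def)
  then have "sort_key r J \<in> incr_tuples (length J)"
    by (simp add: incr_tuples_def sorted_wrt_map r)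
  moreover obtain \<sigma> where "\<sigma> permutes {..<length (sort_key r J)}" "permute_list \<sigma> (sort_key r J) = J"
    using mset_eq_permutation[of J "sort_key r J"] by auto
  ultimately show thesis using that by metis
qed

text \<open>The difference of the two forms must vanish on all tuples of axes. A repeated index is
  killed by alternation; a tuple of distinct indices is an increasing one up to a permutation, which
  only costs a sign.\<close>

lemma forms_eqI:
  assumes "\<phi> \<in> \<Lambda> k" "\<eta> \<in> \<Lambda> k"
    and eq: "\<And>I. I \<in> incr_tuples k \<Longrightarrow> \<phi> (map (\<lambda>i. axis i 1) I) = \<eta> (map (\<lambda>i. axis i 1) I)"
  shows "\<phi> = \<eta>"
proof
  fix vs
  let ?\<psi> = "\<lambda>vs. \<phi> vs - \<eta> vs"
  have \<psi>: "?\<psi> \<in> \<Lambda> k" using assms by (intro forms_diff)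
  have "?\<psi> (map (\<lambda>i. axis i 1) J) = 0" if J: "length J = k" for J
  proof (cases "distinct J")
    case True
    then obtain I \<sigma> where I: "I \<in> incr_tuples k" "\<sigma> permutes {..<length I}" "J = permute_list \<sigma> I"
      using incr_tuple_permutation J by metis
    then have "length I = k" by (simp add: incr_tuples_def)
    with I have "?\<psi> (map (\<lambda>i. axis i 1) J) = of_int (sign \<sigma>) * ?\<psi> (map (\<lambda>i. axis i 1) I)"
      using forms_permute[OF \<psi>, of "map (\<lambda>i. axis i 1) I" \<sigma>] by (simp add: permute_list_map)
    then show ?thesis using eq[OF I(1)] by simp
  next
    case False
    then obtain i j where "i < j" "j < k" "J ! i = J ! j"
      using J by (metis distinct_conv_nth linorder_neqE_nat)
    then show ?thesis
      using J by (intro forms_alternating[OF \<psi>, of i j]) auto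
  qed
  from form_zero_if_axes[OF \<psi> this] show "\<phi> vs = \<eta> vs"
    by simp
qed

section \<open>Increasing multi-indices and coefficients\<close>

lemma ix_less_numeral:
  "1 <\<^sub>4 j \<longleftrightarrow> j = 2 \<or> j = 3 \<or> j = 4" "2 <\<^sub>4 j \<longleftrightarrow> j = 3 \<or> j = 4" "3 <\<^sub>4 j \<longleftrightarrow> j = 4" "\<not> 4 <\<^sub>4 j"
  by (simp_all add: ix_less_def)

lemma pairs_ix_less: "{(i, j). i <\<^sub>4 j} = {(1,2), (1,3), (1,4), (2,3), (2,4), (3,4)}"
proof -
  have "{(i, j). (i, j) \<in> S} = S" for S :: "(4 \<times> 4) set" by auto
  then show ?thesis unfolding ix_less_def .
qed

lemma triple_ix_less_iff:
  "i <\<^sub>4 j \<and> j <\<^sub>4 k \<longleftrightarrow> (i, j, k) \<in> {(1,2,3), (1,2,4), (1,3,4), (2,3,4)}"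
  using exhaust_4[of i] exhaust_4[of j] by (elim disjE) (simp_all add: ix_less_numeral)

lemma triples_ix_less: "{(i, j, k). i <\<^sub>4 j \<and> j <\<^sub>4 k} = {(1,2,3), (1,2,4), (1,3,4), (2,3,4)}"
proof -
  have "{(i, j, k). (i, j, k) \<in> S} = S" for S :: "(4 \<times> 4 \<times> 4) set" by auto
  then show ?thesis unfolding triple_ix_less_iff .
qed

lemma ix_less_trans: "i <\<^sub>4 j \<Longrightarrow> j <\<^sub>4 k \<Longrightarrow> i <\<^sub>4 k"
  using triple_ix_less_iff[of i j k] by (auto simp: ix_less_def)

lemma incr_tuples_0: "incr_tuples 0 = {[]}"
  by (auto simp: incr_tuples_def)

lemma incr_tuples_1: "incr_tuples 1 = {[1], [2], [3], [4]}"
proof -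
  have "incr_tuples 1 = (\<lambda>i. [i]) ` UNIV"
    by (auto simp: incr_tuples_def length_Suc_conv)
  then show ?thesis
    by (simp add: UNIV_4)
qed

lemma incr_tuples_2: "incr_tuples 2 = {[1,2], [1,3], [1,4], [2,3], [2,4], [3,4]}"
proof -
  have "incr_tuples 2 = (\<lambda>(i, j). [i, j]) ` {(i, j). i <\<^sub>4 j}"
    by (auto simp: incr_tuples_def length_Suc_conv numeral_2_eq_2)
  then show ?thesis
    by (simp add: pairs_ix_less)
qed

lemma incr_tuples_3: "incr_tuples 3 = {[1,2,3], [1,2,4], [1,3,4], [2,3,4]}"
proof -
  have "incr_tuples 3 = (\<lambda>(i, j, k). [i, j, k]) ` {(i, j, k). i <\<^sub>4 j \<and> j <\<^sub>4 k}"
    \<comment> \<open>\<open>sorted_wrt\<close> also compares the outer two entries; transitivity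
      supplies this.\<close>
    by (auto simp: incr_tuples_def length_Suc_conv numeral_3_eq_3 image_iff intro: ix_less_trans)
  then show ?thesis
    by (simp add: triples_ix_less)
qed

lemma incr_tuples_4: "incr_tuples 4 = {[1,2,3,4]}"
proof -
  have l: "length I = 4 \<longleftrightarrow> (\<exists>i j k l. I = [i, j, k, l])" for I :: "4 list"
    by (auto simp: length_Suc_conv numeral_eq_Suc)
  have "sorted_wrt (<\<^sub>4) [i, j, k, l] \<longleftrightarrow> [i, j, k, l] = [1, 2, 3, 4]" for i j k l
    using triple_ix_less_iff[of i j k] by (auto simp: ix_less_numeral)
  then show ?thesis
    unfolding incr_tuples_def l by blast
qed

lemma incr_tuples_finite: "finite (incr_tuples k)"
  by (rule finite_subset[OF _ finite_lists_length_eq[OF finite_class.finite_UNIV, of k]])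
    (auto simp: incr_tuples_def)

text \<open>Pigeonhole: an increasing tuple has distinct entries, and there are only four indices.
  This bounds the degrees to be checked in \<open>dx_wedge_axes\<close>.\<close>

lemma incr_tuples_empty:
  assumes "4 < k" shows "incr_tuples k = {}"
proof -
  have False if "I \<in> incr_tuples k" for I
  proof -
    have "i \<noteq> j" if "i <\<^sub>4 j" for i j using that by (auto simp: ix_less_def)
    moreover have I: "length I = k" "sorted_wrt (<\<^sub>4) I"
      using that by (auto simp: incr_tuples_def)
    ultimately have "distinct I"
      by (metis distinct_conv_nth sorted_wrt_nth_less linorder_neqE_nat)
    then have "length I \<le> CARD(4)"
      by (metis card_mono distinct_card finite_class.finite_UNIV subset_UNIV)
    then show False using I assms by simp
  qed
  then show ?thesis by blast
qed

section \<open>The basis forms, their duality with the axes, and the coefficients\<close>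

lemma dx_singleton: "dx i [v] = v $ i"
  by (simp add: dx_def)

lemma dx_in_forms: "dx i \<in> \<Lambda> 1"
proof (rule formsI)
  fix vs :: "(real^4) list" and j :: nat assume "length vs = 1" "j < 1"
  then obtain v where "vs = [v]" by (auto simp: length_Suc_conv)
  then show "linear (\<lambda>x. dx i (vs[j := x]))"
    using \<open>j < 1\<close> by (auto simp: dx_def intro!: linearI)
qed (auto simp: dx_def split: list.split)

lemma unit_form_in_forms: "unit_form \<in> \<Lambda> 0"
  by (rule formsI) (auto simp: unit_form_def)

lemma dx_wedge_simps:
  "dx_wedge [] = unit_form" "dx_wedge (i # I) = dx i \<and>\<^sub>w dx_wedge I"
  by (simp_all add: dx_wedge_def)

lemma dx_wedge_in_forms: "length I = k \<Longrightarrow> dx_wedge I \<in> \<Lambda> k"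
  by (induction I arbitrary: k)
    (use wedge_in_forms[OF dx_in_forms] in \<open>auto simp: dx_wedge_simps unit_form_in_forms\<close>)

lemma dx_wedge_1: "dx_wedge [i] [a] = a $ i"
  using wedge_0_right[OF dx_in_forms unit_form_in_forms, of i]
  by (simp add: dx_wedge_simps dx_def unit_form_def)

lemma dx_wedge_2: "dx_wedge [i, j] [a, b] = a $ i * b $ j - b $ i * a $ j"
  using wedge_1_1[OF dx_in_forms dx_wedge_in_forms, of "[j]"]
  by (simp add: dx_wedge_simps(2)[of i] dx_singleton dx_wedge_1)

text \<open>The minor in rows \<open>i, j, k\<close> of the matrix with columns
  \<open>a, b, c\<close>, expanded along row \<open>i\<close>: \<open>dx_wedge\<close> nests to the
  right, so the first factor is split off.\<close>

lemma dx_wedge_3: "dx_wedge [i, j, k] [a, b, c] =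
   a $ i * (b $ j * c $ k - c $ j * b $ k) - b $ i * (a $ j * c $ k - c $ j * a $ k)
    + c $ i * (a $ j * b $ k - b $ j * a $ k)"
  using wedge_1_2[OF dx_in_forms dx_wedge_in_forms, of "[j, k]"]
  by (simp add: dx_wedge_simps(2)[of i] dx_singleton dx_wedge_2)

lemma dx_wedge_4: "dx_wedge [i, j, k, l] [a, b, c, d] =
   a $ i * dx_wedge [j, k, l] [b, c, d] - b $ i * dx_wedge [j, k, l] [a, c, d]
    + c $ i * dx_wedge [j, k, l] [a, b, d] - d $ i * dx_wedge [j, k, l] [a, b, c]"
  using wedge_1_3[OF dx_in_forms dx_wedge_in_forms, of "[j, k, l]"]
  by (simp add: dx_wedge_simps(2)[of i] dx_singleton)

text \<open>Duality: these values are minors of matrices whose columns are axes, and at most 36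
  pairs of multi-indices occur in each degree.\<close>

lemma dx_wedge_axes:
  assumes "I \<in> incr_tuples k" "J \<in> incr_tuples k"
  shows "dx_wedge I (map (\<lambda>i. axis i 1) J) = of_bool (I = J)"
proof -
  have "k \<le> 4"
    using assms incr_tuples_empty by (metis empty_iff not_le)
  then consider "k = 0" | "k = 1" | "k = 2" | "k = 3" | "k = 4"
    by linarith
  then show ?thesis
  proof cases
    case 1
    then show ?thesis using assms by (simp add: incr_tuples_0 dx_wedge_simps unit_form_def)
  next
    case 2
    then show ?thesis using assms unfolding 2 incr_tuples_1
      by (elim insertE emptyE; simp add: dx_wedge_1 axis_def)
  next
    case 3
    then show ?thesis using assms unfolding 3 incr_tuples_2
      by (elim insertE emptyE; simp add: dx_wedge_2 axis_def)
  next
    case 4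
    then show ?thesis using assms unfolding 4 incr_tuples_3
      by (elim insertE emptyE; simp add: dx_wedge_3 axis_def)
  next
    case 5
    then show ?thesis using assms unfolding 5 incr_tuples_4
      by (elim insertE emptyE; simp add: dx_wedge_4 dx_wedge_3 axis_def)
  qed
qed

text \<open>By \<open>forms_eqI\<close> it suffices to test on increasing tuples of axes, where
  duality leaves one summand.\<close>

lemma forms_expansion:
  assumes \<phi>: "\<phi> \<in> \<Lambda> k"
  shows "\<phi> = (\<lambda>vs. \<Sum>I\<in>incr_tuples k. \<phi> (map (\<lambda>i. axis i 1) I) * dx_wedge I vs)"
proof (rule forms_eqI[OF \<phi>])
  show "(\<lambda>vs. \<Sum>I\<in>incr_tuples k. \<phi> (map (\<lambda>i. axis i 1) I) * dx_wedge I vs) \<in> \<Lambda> k"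
    using dx_wedge_in_forms by (intro forms_sum forms_scale) (auto simp: incr_tuples_def)
next
  fix J assume "J \<in> incr_tuples k"
  then show "\<phi> (map (\<lambda>i. axis i 1) J) =
    (\<Sum>I\<in>incr_tuples k. \<phi> (map (\<lambda>i. axis i 1) I) * dx_wedge I (map (\<lambda>i. axis i 1) J))"
    by (simp add: dx_wedge_axes incr_tuples_finite of_bool_def if_distrib cong: if_cong)
qed

text \<open>Existence for the definite description is \<open>forms_expansion\<close>; uniqueness
  follows by evaluating any expansion on the axes of \<open>J\<close>, where duality isolates
  \<open>c J\<close>.\<close>

lemma coeff_eq:
  assumes \<phi>: "\<phi> \<in> \<Lambda> k" and I: "I \<in> incr_tuples k"
  shows "coeff k \<phi> I = \<phi> (map (\<lambda>i. axis i 1) I)"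
proof -
  \<comment> \<open>The value \<open>0\<close> elsewhere is the normalisation in
    \<open>coeff_def\<close>, which makes the coefficient function unique on all lists.\<close>
  let ?c = "\<lambda>I. if I \<in> incr_tuples k then \<phi> (map (\<lambda>i. axis i 1) I) else 0"
  have "coeff k \<phi> = ?c"
    unfolding coeff_def
  proof (rule the_equality, intro conjI allI impI)
    show "\<phi> = (\<lambda>vs. \<Sum>I\<in>incr_tuples k. ?c I * dx_wedge I vs)"
      by (subst forms_expansion[OF \<phi>]) simp
  next
    fix c assume c: "(\<forall>I. I \<notin> incr_tuples k \<longrightarrow> c I = 0) \<and>
      \<phi> = (\<lambda>vs. \<Sum>I\<in>incr_tuples k. c I * dx_wedge I vs)"
    have "\<phi> (map (\<lambda>i. axis i 1) J) = c J" if "J \<in> incr_tuples k" for J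
      using that c[THEN conjunct2, THEN fun_cong, of "map (\<lambda>i. axis i 1) J"]
      by (simp add: dx_wedge_axes incr_tuples_finite of_bool_def if_distrib cong: if_cong)
    then show "c = ?c"
      using c by auto
  qed simp
  then show ?thesis using I by simp
qed

section \<open>Proxies\<close>

lemma proxy0_eq: "\<phi> \<in> \<Lambda> 0 \<Longrightarrow> proxy0 \<phi> = \<phi> []"
  by (simp add: proxy0_def coeff_eq incr_tuples_0)

lemma proxy1_nth:
  assumes "\<phi> \<in> \<Lambda> 1" shows "proxy1 \<phi> $ i = \<phi> [axis i 1]"
proof -
  have "[i] \<in> incr_tuples 1" by (simp add: incr_tuples_def)
  then show ?thesis using assms by (simp add: proxy1_def coeff_eq)
qed

lemma proxy2_nth:
  assumes "\<phi> \<in> \<Lambda> 2"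
  shows "proxy2 \<phi> $ i $ j =
     \<epsilon> i j 1 2 * \<phi> [axis 1 1, axis 2 1] + \<epsilon> i j 1 3 * \<phi> [axis 1 1, axis 3 1]
   + \<epsilon> i j 1 4 * \<phi> [axis 1 1, axis 4 1] + \<epsilon> i j 2 3 * \<phi> [axis 2 1, axis 3 1]
   + \<epsilon> i j 2 4 * \<phi> [axis 2 1, axis 4 1] + \<epsilon> i j 3 4 * \<phi> [axis 3 1, axis 4 1]"
  by (simp add: proxy2_def pairs_ix_less coeff_eq[OF assms] incr_tuples_2)

text \<open>Only the triple omitting the index contributes, with the sign of moving that index to
  its place from the front.\<close>

lemma proxy3_nth:
  assumes "\<phi> \<in> \<Lambda> 3"
  shows "proxy3 \<phi> $ 1 = \<phi> [axis 2 1, axis 3 1, axis 4 1]"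
    "proxy3 \<phi> $ 2 = - \<phi> [axis 1 1, axis 3 1, axis 4 1]"
    "proxy3 \<phi> $ 3 = \<phi> [axis 1 1, axis 2 1, axis 4 1]"
    "proxy3 \<phi> $ 4 = - \<phi> [axis 1 1, axis 2 1, axis 3 1]"
  by (simp_all add: proxy3_def triples_ix_less coeff_eq[OF assms] incr_tuples_3)

lemma proxy4_eq: "\<phi> \<in> \<Lambda> 4 \<Longrightarrow> proxy4 \<phi> = \<phi> [axis 1 1, axis 2 1, axis 3 1, axis 4 1]"
  by (simp add: proxy4_def coeff_eq incr_tuples_4)

section \<open>Wedge products in terms of proxies\<close>

lemma proxy_wedge_0:
  assumes \<phi>: "\<phi> \<in> \<Lambda> 0"
  shows "\<eta> \<in> \<Lambda> 0 \<Longrightarrow> proxy0 (\<phi> \<and>\<^sub>w \<eta>) = proxy0 \<phi> * proxy0 \<eta>"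
    and "\<eta> \<in> \<Lambda> 1 \<Longrightarrow> proxy1 (\<phi> \<and>\<^sub>w \<eta>) = proxy0 \<phi> *\<^sub>R proxy1 \<eta>"
    and "\<eta> \<in> \<Lambda> 2 \<Longrightarrow> proxy2 (\<phi> \<and>\<^sub>w \<eta>) = proxy0 \<phi> *\<^sub>R proxy2 \<eta>"
    and "\<eta> \<in> \<Lambda> 3 \<Longrightarrow> proxy3 (\<phi> \<and>\<^sub>w \<eta>) = proxy0 \<phi> *\<^sub>R proxy3 \<eta>"
    and "\<eta> \<in> \<Lambda> 4 \<Longrightarrow> proxy4 (\<phi> \<and>\<^sub>w \<eta>) = proxy0 \<phi> * proxy4 \<eta>"
proof -
  show "proxy0 (\<phi> \<and>\<^sub>w \<eta>) = proxy0 \<phi> * proxy0 \<eta>" if "\<eta> \<in> \<Lambda> 0"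
    using that by (simp add: wedge_0_left[OF \<phi>] proxy0_eq \<phi> forms_scale)
  show "proxy1 (\<phi> \<and>\<^sub>w \<eta>) = proxy0 \<phi> *\<^sub>R proxy1 \<eta>" if "\<eta> \<in> \<Lambda> 1"
    using that by (simp add: wedge_0_left[OF \<phi> that] proxy0_eq[OF \<phi>] proxy1_nth forms_scale vec_eq_iff del: One_nat_def)
  show "proxy2 (\<phi> \<and>\<^sub>w \<eta>) = proxy0 \<phi> *\<^sub>R proxy2 \<eta>" if "\<eta> \<in> \<Lambda> 2"
    by (simp add: wedge_0_left[OF \<phi> that] proxy0_eq[OF \<phi>] proxy2_nth[OF that]
        proxy2_nth[OF forms_scale[OF that]] vec_eq_iff distrib_left mult.left_commute)
  show "proxy3 (\<phi> \<and>\<^sub>w \<eta>) = proxy0 \<phi> *\<^sub>R proxy3 \<eta>" if "\<eta> \<in> \<Lambda> 3"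
    using that by (simp add: wedge_0_left[OF \<phi> that] proxy0_eq[OF \<phi>] proxy3_nth forms_scale vec_eq_iff forall_4)
  show "proxy4 (\<phi> \<and>\<^sub>w \<eta>) = proxy0 \<phi> * proxy4 \<eta>" if "\<eta> \<in> \<Lambda> 4"
    using that by (simp add: wedge_0_left[OF \<phi> that] proxy0_eq[OF \<phi>] proxy4_eq forms_scale)
qed

lemma wedge_0_commute: "\<phi> \<in> \<Lambda> 0 \<Longrightarrow> \<eta> \<in> \<Lambda> k \<Longrightarrow> \<eta> \<and>\<^sub>w \<phi> = \<phi> \<and>\<^sub>w \<eta>"
  by (simp add: wedge_0_left wedge_0_right mult.commute)

text \<open>The coefficient of the wedge at \<open>k, l\<close> is antisymmetrised. Since
  \<open>\<epsilon>\<close> is antisymmetric in its last two slots, the sum over increasing pairs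
  equals the full double sum in \<open>cross_vec\<close>.\<close>

lemma proxy2_wedge_1_1:
  assumes \<phi>: "\<phi> \<in> \<Lambda> 1" and \<eta>: "\<eta> \<in> \<Lambda> 1"
  shows "proxy2 (\<phi> \<and>\<^sub>w \<eta>) = proxy1 \<phi> \<times>\<^sub>v proxy1 \<eta>"
    and "- proxy2 (\<eta> \<and>\<^sub>w \<phi>) = proxy2 (\<phi> \<and>\<^sub>w \<eta>)"
proof -
  have f: "\<phi> \<and>\<^sub>w \<eta> \<in> \<Lambda> 2" "\<eta> \<and>\<^sub>w \<phi> \<in> \<Lambda> 2"
    using wedge_in_forms[OF \<phi> \<eta>] wedge_in_forms[OF \<eta> \<phi>] by (simp_all flip: numeral_2_eq_2)
  show "proxy2 (\<phi> \<and>\<^sub>w \<eta>) = proxy1 \<phi> \<times>\<^sub>v proxy1 \<eta>"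
    unfolding vec_eq_iff forall_4 proxy2_nth[OF f(1)] cross_vec_def wedge_1_1[OF \<phi> \<eta>]
    by (simp add: sum_4 proxy1_nth[OF \<phi>] proxy1_nth[OF \<eta>])
  show "- proxy2 (\<eta> \<and>\<^sub>w \<phi>) = proxy2 (\<phi> \<and>\<^sub>w \<eta>)"
    by (simp add: vec_eq_iff proxy2_nth f wedge_1_1[OF \<phi> \<eta>] wedge_1_1[OF \<eta> \<phi>] algebra_simps)
qed

text \<open>Row \<open>i\<close> of \<open>proxy2 \<eta>\<close> joins the component of
  \<open>\<phi>\<close> at \<open>j\<close> with the coefficient of \<open>\<eta>\<close> at the two
  indices other than \<open>i\<close> and \<open>j\<close>: this is the shuffle expansion on the
  triple omitting \<open>i\<close>.\<close>

lemma proxy3_wedge_1_2: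
  assumes \<phi>: "\<phi> \<in> \<Lambda> 1" and \<eta>: "\<eta> \<in> \<Lambda> 2"
  shows "proxy3 (\<phi> \<and>\<^sub>w \<eta>) = proxy2 \<eta> *v proxy1 \<phi>"
    and "proxy3 (\<eta> \<and>\<^sub>w \<phi>) = proxy3 (\<phi> \<and>\<^sub>w \<eta>)"
proof -
  have f: "\<phi> \<and>\<^sub>w \<eta> \<in> \<Lambda> 3" "\<eta> \<and>\<^sub>w \<phi> \<in> \<Lambda> 3"
    using wedge_in_forms[OF \<phi> \<eta>] wedge_in_forms[OF \<eta> \<phi>] by (simp_all add: numeral_3_eq_3)
  show "proxy3 (\<phi> \<and>\<^sub>w \<eta>) = proxy2 \<eta> *v proxy1 \<phi>"
    unfolding vec_eq_iff forall_4 proxy3_nth[OF f(1)] wedge_1_2[OF \<phi> \<eta>] matrix_vector_mult_def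
    by (simp add: sum_4 proxy1_nth[OF \<phi>] proxy2_nth[OF \<eta>])
  show "proxy3 (\<eta> \<and>\<^sub>w \<phi>) = proxy3 (\<phi> \<and>\<^sub>w \<eta>)"
    unfolding vec_eq_iff forall_4 proxy3_nth[OF f(1)] proxy3_nth[OF f(2)] wedge_1_2[OF \<phi> \<eta>] wedge_2_1[OF \<eta> \<phi>]
    by simp
qed

text \<open>The alternating signs of \<open>wedge_1_3\<close> are those built into
  \<open>proxy3\<close>. Reversing the factors moves a \<open>1\<close>-form past three others,
  hence the minus sign.\<close>

lemma proxy4_wedge_1_3:
  assumes \<phi>: "\<phi> \<in> \<Lambda> 1" and \<eta>: "\<eta> \<in> \<Lambda> 3"
  shows "proxy4 (\<phi> \<and>\<^sub>w \<eta>) = proxy1 \<phi> \<bullet> proxy3 \<eta>"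
    and "- proxy4 (\<eta> \<and>\<^sub>w \<phi>) = proxy4 (\<phi> \<and>\<^sub>w \<eta>)"
proof -
  have f: "\<phi> \<and>\<^sub>w \<eta> \<in> \<Lambda> 4" "\<eta> \<and>\<^sub>w \<phi> \<in> \<Lambda> 4"
    using wedge_in_forms[OF \<phi> \<eta>] wedge_in_forms[OF \<eta> \<phi>] by simp_all
  show "proxy4 (\<phi> \<and>\<^sub>w \<eta>) = proxy1 \<phi> \<bullet> proxy3 \<eta>"
    by (simp add: proxy4_eq[OF f(1)] wedge_1_3[OF \<phi> \<eta>] inner_vec_def sum_4 proxy1_nth[OF \<phi>] proxy3_nth[OF \<eta>])
  show "- proxy4 (\<eta> \<and>\<^sub>w \<phi>) = proxy4 (\<phi> \<and>\<^sub>w \<eta>)"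
    by (simp add: proxy4_eq f wedge_1_3[OF \<phi> \<eta>] wedge_3_1[OF \<eta> \<phi>])
qed

text \<open>\<open>proxy2\<close> moves each coefficient to the complementary pair, and
  \<open>\<times>\<^sub>K\<close> again pairs complementary entries. As
  \<open>\<epsilon> i j k l = \<epsilon> k l i j\<close>, one sign survives per term: that of the
  splitting in \<open>wedge_2_2\<close>.\<close>

lemma proxy4_wedge_2_2:
  assumes \<phi>: "\<phi> \<in> \<Lambda> 2" and \<eta>: "\<eta> \<in> \<Lambda> 2"
  shows "proxy4 (\<phi> \<and>\<^sub>w \<eta>) = proxy2 \<phi> \<times>\<^sub>K proxy2 \<eta>"
    and "proxy4 (\<eta> \<and>\<^sub>w \<phi>) = proxy4 (\<phi> \<and>\<^sub>w \<eta>)"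
proof -
  have f: "\<phi> \<and>\<^sub>w \<eta> \<in> \<Lambda> 4" "\<eta> \<and>\<^sub>w \<phi> \<in> \<Lambda> 4"
    using wedge_in_forms[OF \<phi> \<eta>] wedge_in_forms[OF \<eta> \<phi>] by simp_all
  show "proxy4 (\<phi> \<and>\<^sub>w \<eta>) = proxy2 \<phi> \<times>\<^sub>K proxy2 \<eta>"
    by (simp add: proxy4_eq[OF f(1)] wedge_2_2[OF \<phi> \<eta>] cross_skew_def pairs_ix_less
       proxy2_nth[OF \<phi>] proxy2_nth[OF \<eta>])
  show "proxy4 (\<eta> \<and>\<^sub>w \<phi>) = proxy4 (\<phi> \<and>\<^sub>w \<eta>)"
    by (simp add: proxy4_eq f wedge_2_2[OF \<phi> \<eta>] wedge_2_2[OF \<eta> \<phi>])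
qed

section \<open>Values of forms on vectors\<close>

lemma form_1_apply:
  assumes "\<phi> \<in> \<Lambda> 1" shows "\<phi> [v] = proxy1 \<phi> \<bullet> v"
proof -
  have "\<phi> [v] = (\<Sum>I\<in>incr_tuples 1. \<phi> (map (\<lambda>i. axis i 1) I) * dx_wedge I [v])"
    using forms_expansion[OF assms] by (rule fun_cong)
  then show ?thesis
    unfolding incr_tuples_1 by (simp add: dx_wedge_1 inner_vec_def sum_4 proxy1_nth[OF assms])
qed

text \<open>Entry \<open>i, j\<close> of either matrix carries the data of the complementary pair
  with the same sign, so the signs cancel in the product.\<close>

lemma form_2_apply:
  assumes "\<phi> \<in> \<Lambda> 2" shows "\<phi> [u, v] = 1 / 2 * (proxy2 \<phi> \<bullet> (u \<times>\<^sub>v v))"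
proof -
  have "\<phi> [u, v] = (\<Sum>I\<in>incr_tuples 2. \<phi> (map (\<lambda>i. axis i 1) I) * dx_wedge I [u, v])"
    using forms_expansion[OF assms] by (rule fun_cong)
  then show ?thesis
    unfolding incr_tuples_2
    by (simp add: dx_wedge_2 inner_vec_def sum_4 proxy2_nth[OF assms] cross_vec_def algebra_simps)
qed

text \<open>Cofactor expansion along the first column: the signs in \<open>proxy3\<close> cancel the
  cofactor signs, leaving the minors \<open>dx_wedge_3\<close>.\<close>

lemma form_3_apply:
  assumes "\<phi> \<in> \<Lambda> 3" shows "\<phi> [u, v, w] = det_cols (proxy3 \<phi>) u v w"
proof -
  have "\<phi> [u, v, w] = (\<Sum>I\<in>incr_tuples 3. \<phi> (map (\<lambda>i. axis i 1) I) * dx_wedge I [u, v, w])"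
    using forms_expansion[OF assms] by (rule fun_cong)
  then show ?thesis
    unfolding incr_tuples_3 det_cols_def det_4
    by (simp add: dx_wedge_3 proxy3_nth[OF assms] Finite_Cartesian_Product.transpose_def algebra_simps)
qed

lemma form_4_apply:
  assumes "\<phi> \<in> \<Lambda> 4" shows "\<phi> [u, v, w, z] = proxy4 \<phi> * det_cols u v w z"
proof -
  have "\<phi> [u, v, w, z] = (\<Sum>I\<in>incr_tuples 4. \<phi> (map (\<lambda>i. axis i 1) I) * dx_wedge I [u, v, w, z])"
    using forms_expansion[OF assms] by (rule fun_cong)
  \<comment> \<open>The only basis form of degree four is the determinant, here expanded along its
    rows.\<close>
  moreover have "dx_wedge [1, 2, 3, 4] [u, v, w, z] = det_cols u v w z"
    unfolding det_cols_def det_4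
    by (simp add: dx_wedge_4 dx_wedge_3 Finite_Cartesian_Product.transpose_def algebra_simps)
  ultimately show ?thesis
    unfolding incr_tuples_4 by (simp add: proxy4_eq[OF assms])
qed

theorem proposition4p1:
  shows "(\<forall>\<phi>\<in>\<Lambda> 0.
            (\<forall>\<eta>\<in>\<Lambda> 0. proxy0 (\<eta> \<and>\<^sub>w \<phi>) = proxy0 (\<phi> \<and>\<^sub>w \<eta>) \<and>
                        proxy0 (\<phi> \<and>\<^sub>w \<eta>) = proxy0 \<phi> * proxy0 \<eta>) \<and>
            (\<forall>\<eta>\<in>\<Lambda> 1. proxy1 (\<eta> \<and>\<^sub>w \<phi>) = proxy1 (\<phi> \<and>\<^sub>w \<eta>) \<and>
                        proxy1 (\<phi> \<and>\<^sub>w \<eta>) = proxy0 \<phi> *\<^sub>R proxy1 \<eta>) \<and>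
            (\<forall>\<eta>\<in>\<Lambda> 2. proxy2 (\<eta> \<and>\<^sub>w \<phi>) = proxy2 (\<phi> \<and>\<^sub>w \<eta>) \<and>
                        proxy2 (\<phi> \<and>\<^sub>w \<eta>) = proxy0 \<phi> *\<^sub>R proxy2 \<eta>) \<and>
            (\<forall>\<eta>\<in>\<Lambda> 3. proxy3 (\<eta> \<and>\<^sub>w \<phi>) = proxy3 (\<phi> \<and>\<^sub>w \<eta>) \<and>
                        proxy3 (\<phi> \<and>\<^sub>w \<eta>) = proxy0 \<phi> *\<^sub>R proxy3 \<eta>) \<and>
            (\<forall>\<eta>\<in>\<Lambda> 4. proxy4 (\<eta> \<and>\<^sub>w \<phi>) = proxy4 (\<phi> \<and>\<^sub>w \<eta>) \<and>
                        proxy4 (\<phi> \<and>\<^sub>w \<eta>) = proxy0 \<phi> * proxy4 \<eta>)) \<and>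
         (\<forall>\<phi>\<in>\<Lambda> 1. \<forall>\<eta>\<in>\<Lambda> 1. - proxy2 (\<eta> \<and>\<^sub>w \<phi>) = proxy2 (\<phi> \<and>\<^sub>w \<eta>) \<and>
                                proxy2 (\<phi> \<and>\<^sub>w \<eta>) = proxy1 \<phi> \<times>\<^sub>v proxy1 \<eta>) \<and>
         (\<forall>\<phi>\<in>\<Lambda> 1. \<forall>\<eta>\<in>\<Lambda> 2. proxy3 (\<eta> \<and>\<^sub>w \<phi>) = proxy3 (\<phi> \<and>\<^sub>w \<eta>) \<and>
                                proxy3 (\<phi> \<and>\<^sub>w \<eta>) = proxy2 \<eta> *v proxy1 \<phi>) \<and>
         (\<forall>\<phi>\<in>\<Lambda> 1. \<forall>\<eta>\<in>\<Lambda> 3. - proxy4 (\<eta> \<and>\<^sub>w \<phi>) = proxy4 (\<phi> \<and>\<^sub>w \<eta>) \<and>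
                                proxy4 (\<phi> \<and>\<^sub>w \<eta>) = proxy1 \<phi> \<bullet> proxy3 \<eta>) \<and>
         (\<forall>\<phi>\<in>\<Lambda> 2. \<forall>\<eta>\<in>\<Lambda> 2. proxy4 (\<eta> \<and>\<^sub>w \<phi>) = proxy4 (\<phi> \<and>\<^sub>w \<eta>) \<and>
                                proxy4 (\<phi> \<and>\<^sub>w \<eta>) = proxy2 \<phi> \<times>\<^sub>K proxy2 \<eta>) \<and>
         (\<forall>\<phi>\<in>\<Lambda> 1. \<forall>v. \<phi> [v] = proxy1 \<phi> \<bullet> v) \<and>
         (\<forall>\<phi>\<in>\<Lambda> 2. \<forall>u v. \<phi> [u, v] = 1 / 2 * (proxy2 \<phi> \<bullet> (u \<times>\<^sub>v v))) \<and>
         (\<forall>\<phi>\<in>\<Lambda> 3. \<forall>u v w. \<phi> [u, v, w] = det_cols (proxy3 \<phi>) u v w) \<and>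
         (\<forall>\<phi>\<in>\<Lambda> 4. \<forall>u v w z. \<phi> [u, v, w, z] = proxy4 \<phi> * det_cols u v w z)"
  \<comment> \<open>The goals left to \<open>wedge_0_commute\<close> are those exchanging a
    \<open>0\<close>-form with another form; there the forms themselves agree, not only their
    proxies.\<close>
  by (intro conjI ballI allI;
      ((rule proxy_wedge_0 proxy2_wedge_1_1 proxy3_wedge_1_2 proxy4_wedge_1_3 proxy4_wedge_2_2
        form_1_apply form_2_apply form_3_apply form_4_apply; assumption)
      | simp only: wedge_0_commute))

end
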